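(* Let $\Theta=\{(a,b)\in\mathbb{R}^2: -\infty<a<b<\infty\}$ and let $E=\{(k2^m,(k+1)2^m): k,m\in\mathbb{Z}\}\subset\mathbb{R}^2$. For $(a,b)\in\Theta$ let $C(a,b)$ be the set of pairs $(p,q)=(k2^m,(k+1)2^m)\in E$ such that the open interval $(p,q)$ is contained in the open interval $(a,b)$ and such that $(k+2)2^m>b$ if $k$ is even, or $(k-1)2^m<a$ if $k$ is odd. Then, for each $(a,b)\in\Theta$, $$\mathrm{unif}(a,b)=\sum_{(p,q)\in E} w_{(a,b)}(p,q)\,\mathrm{unif}(p,q),$$ where the mixing coefficients are given by $$w_{(a,b)}(p,q)=\begin{cases}\dfrac{2^m}{b-a}, & \text{if } (p,q)=(k2^m,(k+1)2^m)\in C(a,b),\\[2mm] 0, & \text{otherwise.}\end{cases}$$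
   Context: For real $a<b$, $\mathrm{unif}(a,b)$ denotes the uniform distribution on the interval $(a,b)$, a probability measure on the Borel subsets of $\mathbb{R}$. The identity between measures means equality on every Borel set. The displayed identity is a discrete mixture representation, so $w_{(a,b)}$ is a probability mass function on the countable set $E$. (Each element of $E$ determines the integers $k,m$ uniquely.) *)

theory Defs
  imports "HOL-Probability.Probability"
begin

definition unif :: "real \<Rightarrow> real \<Rightarrow> real measure" where
  "unif a b = uniform_measure lborel {a<..<b}"

definition Theta :: "(real \<times> real) set" where
  "Theta = {(a, b). a < b}"

definition dyadic :: "int \<Rightarrow> int \<Rightarrow> real \<times> real" where
  "dyadic k m = (of_int k * 2 powi m, of_int (k + 1) * 2 powi m)"

definition E :: "(real \<times> real) set" where
  "E = {dyadic k m | k m. True}"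

definition C :: "real \<Rightarrow> real \<Rightarrow> (real \<times> real) set" where
  "C a b = {(p, q). \<exists>k m. (p, q) = dyadic k m \<and> {p<..<q} \<subseteq> {a<..<b} \<and>
     (if even k then of_int (k + 2) * 2 powi m > b else of_int (k - 1) * 2 powi m < a)}"

text \<open>The scale exponent \<open>m\<close> of an element of \<open>E\<close>; well defined by \<open>dyadic_exp_dyadic\<close> below.\<close>

definition dyadic_exp :: "real \<times> real \<Rightarrow> int" where
  "dyadic_exp e = (THE m. \<exists>k. e = dyadic k m)"

definition w :: "real \<Rightarrow> real \<Rightarrow> real \<times> real \<Rightarrow> real" where
  "w a b e = (if e \<in> C a b then 2 powi dyadic_exp e / (b - a) else 0)"

lemma dyadic_eq_iff: "dyadic k m = dyadic k' m' \<longleftrightarrow> k = k' \<and> m = m'"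
proof
  assume eq: "dyadic k m = dyadic k' m'"
  have "snd (dyadic k m) - fst (dyadic k m) = snd (dyadic k' m') - fst (dyadic k' m')"
    by (simp add: eq)
  then have "(2::real) powi m = 2 powi m'"
    by (simp add: dyadic_def algebra_simps)
  then have "(2::real) powr of_int m = 2 powr of_int m'"
    by (simp add: powr_real_of_int')
  then have "m = m'"
    by (simp add: powr_inj)
  with eq show "k = k' \<and> m = m'"
    by (simp add: dyadic_def)
qed simp

lemma dyadic_exp_dyadic: "dyadic_exp (dyadic k m) = m"
  by (auto simp: dyadic_exp_def dyadic_eq_iff)

end

theory Submission
  imports Defs
begin

text \<open>
  The dyadic intervals form a binary tree: the parent of the interval with index \<open>k\<close> at scale
  \<open>2\<^sup>m\<close> is the interval with index \<open>k div 2\<close> at scale \<open>2\<^sup>m\<^sup>+\<^sup>1\<close>, so it extends its child to the right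
  if \<open>k\<close> is even and to the left if \<open>k\<close> is odd.  The parity condition in the definition of
  \<open>C a b\<close> therefore says that the parent does not fit into \<open>(a, b)\<close>: \<open>C a b\<close> consists of the
  maximal dyadic subintervals of \<open>(a, b)\<close> (\<open>dyadic_in_C_iff\<close>).

  Made half-open, these maximal intervals partition \<open>(a, b)\<close>.  A point \<open>x\<close> with \<open>a < x < b\<close> lies in
  exactly one half-open dyadic interval at each scale, and these intervals increase with the scale.
  They fit into \<open>(a, b)\<close> at small scales and are longer than \<open>b - a\<close> at large ones, so there is
  exactly one scale that still fits while the next one does not
  (\<open>ex1_maximal_dyadic_interval\<close>).

  Lebesgue measure does not see the left endpoints, so by countable additivity
  \<open>\<lambda>(A \<inter> (a, b)) = \<Sum> \<lambda>(A \<inter> (p, q))\<close>, summed over \<open>C a b\<close>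
  (\<open>has_sum_lborel_over_maximal_dyadic_intervals\<close>).  Division by \<open>b - a\<close> gives the claim, as
  \<open>(p, q)\<close> has length \<open>2\<^sup>m\<close>; the case \<open>A = UNIV\<close> says that the weights sum to one.
\<close>

section \<open>Countable additivity over a countable index set\<close>

lemma has_sum_measure_UN_countable:
  assumes "countable I"
    and sets: "\<And>i. i \<in> I \<Longrightarrow> F i \<in> sets M"
    and disj: "disjoint_family_on F I"
    and fin: "emeasure M (\<Union>i\<in>I. F i) \<noteq> \<infinity>"
  shows "((\<lambda>i. measure M (F i)) has_sum measure M (\<Union>i\<in>I. F i)) I"
proof -
  define h where "h = to_nat_on I"
  have inj: "inj_on h I"
    unfolding h_def using assms(1) by (rule inj_on_to_nat_on)
  \<comment> \<open>Transport the family along an injection into the naturals, padded with empty sets.\<close>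
  define G where "G n = (if n \<in> h ` I then F (inv_into I h n) else {})" for n
  have G_h: "G (h i) = F i" if "i \<in> I" for i
    using that inj by (simp add: G_def)
  have UN: "(\<Union>n. G n) = (\<Union>i\<in>I. F i)"
  proof -
    have "(\<Union>n. G n) = (\<Union>n\<in>h ` I. G n)"
      by (auto simp: G_def split: if_splits)
    then show ?thesis
      by (simp add: G_h)
  qed
  have "range G \<subseteq> sets M"
    using sets by (auto simp: G_def inv_into_into)
  moreover have "disjoint_family G"
    using disj inj by (fastforce simp: G_def disjoint_family_on_def)
  ultimately have "(\<lambda>n. measure M (G n)) sums measure M (\<Union>i\<in>I. F i)"
    using measure_UNION[of G M] fin by (simp add: UN)
  then have "((\<lambda>n. measure M (G n)) has_sum measure M (\<Union>i\<in>I. F i)) UNIV"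
    by (rule sums_nonneg_imp_has_sum) simp
  also have "?this \<longleftrightarrow> ((\<lambda>n. measure M (G n)) has_sum measure M (\<Union>i\<in>I. F i)) (h ` I)"
    by (rule has_sum_cong_neutral) (auto simp: G_def)
  also have "\<dots> \<longleftrightarrow> ((\<lambda>i. measure M (F i)) has_sum measure M (\<Union>i\<in>I. F i)) I"
    unfolding has_sum_reindex[OF inj] by (rule has_sum_cong) (simp add: G_h)
  finally show ?thesis .
qed

section \<open>The tree of dyadic intervals\<close>

text \<open>For nonempty intervals this is inclusion in \<open>(a, b)\<close>; it is stated on the endpoints so that it
  serves open and half-open intervals alike.\<close>

definition fits :: "real \<Rightarrow> real \<Rightarrow> real \<times> real \<Rightarrow> bool" where
  "fits a b e \<longleftrightarrow> a \<le> fst e \<and> snd e \<le> b"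

definition cell :: "real \<Rightarrow> int \<Rightarrow> real \<times> real" where
  "cell x m = dyadic \<lfloor>x / 2 powi m\<rfloor> m"

text \<open>Half-open intervals, unlike the open ones of the mixture, contain every point exactly once at
  each scale, so no exceptional set of dyadic points has to be carried along.\<close>

lemma mem_dyadic_iff: "x \<in> {fst (dyadic k m)..<snd (dyadic k m)} \<longleftrightarrow> k = \<lfloor>x / 2 powi m\<rfloor>"
proof -
  have "0 < (2::real) powi m" by simp
  then show ?thesis
    unfolding eq_commute[of k] floor_eq_iff by (simp add: dyadic_def field_simps)
qed

lemma parent_cell: "cell x (m + 1) = dyadic (\<lfloor>x / 2 powi m\<rfloor> div 2) (m + 1)"
proof -
  have "x / 2 powi (m + 1) = (x / 2 powi m) / real_of_int 2"
    by (simp add: power_int_add_1)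
  then have "\<lfloor>x / 2 powi (m + 1)\<rfloor> = \<lfloor>x / 2 powi m\<rfloor> div 2"
    by (simp only: floor_divide_real_eq_div)
  then show ?thesis
    by (simp add: cell_def)
qed

lemma dyadic_parent:
  "dyadic (k div 2) (m + 1) =
     (if even k then (of_int k * 2 powi m, of_int (k + 2) * 2 powi m)
      else (of_int (k - 1) * 2 powi m, of_int (k + 1) * 2 powi m))"
proof -
  have "(2::real) powi (m + 1) = 2 * 2 powi m"
    by (simp add: power_int_add_1)
  then show ?thesis
    unfolding dyadic_def by (cases "even k") (auto simp: algebra_simps elim!: evenE oddE)
qed

lemma fits_child: "fits a b (dyadic k m)" if "fits a b (dyadic (k div 2) (m + 1))"
proof -
  define u where "u = (2::real) powi m"
  have "0 < u" by (simp add: u_def)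
  with that show ?thesis
    unfolding dyadic_parent
    by (auto simp: fits_def dyadic_def algebra_simps simp flip: u_def split: if_splits)
qed

text \<open>The half-open dyadic intervals that contain \<open>x\<close> grow with the scale, so once one of them
  leaves the interval, all later ones do.\<close>

lemma fits_cell_antimono:
  assumes "m \<le> n" and "fits a b (cell x n)"
  shows "fits a b (cell x m)"
  using assms
proof (induction n rule: int_ge_induct)
  case (step n)
  then show ?case
    using fits_child[of a b "\<lfloor>x / 2 powi n\<rfloor>" n] unfolding parent_cell
    by (simp add: cell_def)
qed

text \<open>The parent shares one endpoint with its child and fits there if the child does; that it does
  not fit at its other end is the parity condition in \<open>C\<close>.\<close>

lemma dyadic_in_C_iff:
  "dyadic k m \<in> C a b \<longleftrightarrow>
     fits a b (dyadic k m) \<and> \<not> fits a b (dyadic (k div 2) (m + 1))"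
proof -
  have pos: "0 < (2::real) powi m" by simp
  have "dyadic k m \<in> C a b \<longleftrightarrow>
      {fst (dyadic k m)<..<snd (dyadic k m)} \<subseteq> {a<..<b} \<and>
      (if even k then of_int (k + 2) * 2 powi m > b else of_int (k - 1) * 2 powi m < a)"
    unfolding C_def by (cases "dyadic k m") (auto simp: dyadic_eq_iff dest: sym)
  also have "{fst (dyadic k m)<..<snd (dyadic k m)} \<subseteq> {a<..<b} \<longleftrightarrow> fits a b (dyadic k m)"
    using pos by (simp add: fits_def greaterThanLessThan_subseteq_greaterThanLessThan
        dyadic_def algebra_simps)
  finally show ?thesis
    unfolding dyadic_parent by (auto simp: fits_def dyadic_def)
qed

lemma cell_in_C_iff: "cell x m \<in> C a b \<longleftrightarrow> fits a b (cell x m) \<and> \<not> fits a b (cell x (m + 1))"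
  unfolding parent_cell by (simp add: cell_def dyadic_in_C_iff)

section \<open>Maximal dyadic intervals partition the interval\<close>

lemma cell_bounds:
  "fst (cell x m) \<le> x" "x < snd (cell x m)" "snd (cell x m) - fst (cell x m) = 2 powi m"
  using mem_dyadic_iff[of x "\<lfloor>x / 2 powi m\<rfloor>" m]
  by (auto simp: cell_def dyadic_def algebra_simps)

lemma fits_small_cell: "\<exists>m. fits a b (cell x m)" if "a < x" "x < b"
proof -
  have "0 < min (x - a) (b - x)"
    using that by simp
  then obtain n where n: "(1 / 2) ^ n < min (x - a) (b - x)"
    using real_arch_pow_inv[of "min (x - a) (b - x)" "1 / 2"] by auto
  moreover have "(2::real) powi (- int n) = (1 / 2) ^ n"
    by (simp add: power_int_minus power_one_over inverse_eq_divide)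
  ultimately have "fits a b (cell x (- int n))"
    using cell_bounds[of x "- int n"] by (simp add: fits_def)
  then show ?thesis ..
qed

lemma not_fits_large_cell: "\<exists>n\<ge>m. \<not> fits a b (cell x n)"
proof -
  obtain N where N: "b - a < 2 ^ N"
    using real_arch_pow[of 2 "b - a"] by auto
  define n where "n = max m (int N)"
  have "(2::real) ^ N \<le> 2 powi n"
    using power_int_increasing[of "int N" n "2::real"] by (simp add: n_def)
  then have "\<not> fits a b (cell x n)"
    using N cell_bounds(3)[of x n] by (simp add: fits_def)
  then show ?thesis
    by (intro exI[of _ n]) (simp add: n_def)
qed

text \<open>The scales at which the dyadic interval around \<open>x\<close> fits form a downward closed,
  nonempty set that is bounded above; such a set of integers has exactly one element whose successor is
  missing.\<close>

lemma ex1_maximal_cell: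
  assumes "a < x" "x < b"
  shows "\<exists>!m. cell x m \<in> C a b"
proof -
  obtain m where m: "fits a b (cell x m)"
    using fits_small_cell[OF assms] by blast
  obtain n where n: "n \<ge> m" "\<not> fits a b (cell x n)"
    using not_fits_large_cell by blast
  have "\<exists>i\<ge>m. cell x i \<in> C a b"
  proof (rule ccontr)
    assume no_max: "\<not> ?thesis"
    have "fits a b (cell x n)"
      using n(1) by (induction n rule: int_ge_induct) (use m no_max cell_in_C_iff in auto)
    with n(2) show False ..
  qed
  moreover have "i = j" if "cell x i \<in> C a b" "cell x j \<in> C a b" for i j
    using that fits_cell_antimono[of "i + 1" j a b x] fits_cell_antimono[of "j + 1" i a b x]
    unfolding cell_in_C_iff by linarith
  ultimately show ?thesis by blast
qed

lemma C_subset_E: "C a b \<subseteq> E"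
  by (auto simp: C_def E_def)

lemma ex1_maximal_dyadic_interval:
  assumes "a < x" "x < b"
  shows "\<exists>!e. e \<in> C a b \<and> x \<in> {fst e..<snd e}"
proof -
  have mem_iff: "e \<in> C a b \<and> x \<in> {fst e..<snd e} \<longleftrightarrow> e \<in> C a b \<and> (\<exists>m. e = cell x m)" for e
  proof
    assume e: "e \<in> C a b \<and> x \<in> {fst e..<snd e}"
    then obtain k m where "e = dyadic k m"
      using C_subset_E[of a b] unfolding E_def by blast
    with e show "e \<in> C a b \<and> (\<exists>m. e = cell x m)"
      using mem_dyadic_iff[of x k m] by (auto simp: cell_def)
  qed (use cell_bounds in auto)
  show ?thesis
    unfolding mem_iff using ex1_maximal_cell[OF assms] by metis
qed

section \<open>Decomposition of Lebesgue measure and of the uniform distribution\<close>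

lemma countable_E: "countable E"
proof -
  have "E = range (\<lambda>(k, m). dyadic k m)"
    unfolding E_def by (auto simp: image_iff) metis
  then show ?thesis by (metis countable_image countableI_type)
qed

text \<open>The partition is by half-open intervals cut down to \<open>(a, b)\<close>; each piece differs from the open
  interval by at most its left endpoint, a null set.\<close>

lemma has_sum_lborel_over_maximal_dyadic_intervals:
  assumes A: "A \<in> sets borel"
  shows "((\<lambda>(p, q). measure lborel ({p<..<q} \<inter> A)) has_sum measure lborel ({a<..<b} \<inter> A)) (C a b)"
proof -
  define F where "F e = {a<..<b} \<inter> A \<inter> {fst e..<snd e}" for e :: "real \<times> real"
  have UN: "(\<Union>e\<in>C a b. F e) = {a<..<b} \<inter> A"
    using ex1_maximal_dyadic_interval[of a _ b] by (fastforce simp: F_def)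
  have "countable (C a b)"
    using countable_E C_subset_E by (rule countable_subset[rotated])
  moreover have "F e \<in> sets lborel" for e
    using A by (simp add: F_def)
  moreover have "disjoint_family_on F (C a b)"
    unfolding disjoint_family_on_def F_def using ex1_maximal_dyadic_interval[of a _ b] by fastforce
  moreover have "emeasure lborel ({a<..<b} \<inter> A) \<noteq> \<infinity>"
  proof -
    have "emeasure lborel ({a<..<b} \<inter> A) \<le> emeasure lborel {a<..<b}"
      by (rule emeasure_mono) auto
    also have "\<dots> < \<infinity>"
      by (cases "a \<le> b") auto
    finally show ?thesis by simp
  qed
  ultimately have "((\<lambda>e. measure lborel (F e)) has_sum measure lborel ({a<..<b} \<inter> A)) (C a b)"
    using has_sum_measure_UN_countable[of "C a b" F lborel] by (simp add: UN)
  also have "?this \<longleftrightarrow> ?thesis"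
  proof (rule has_sum_cong)
    fix e assume e: "e \<in> C a b"
    then obtain k m where "e = dyadic k m"
      using C_subset_E[of a b] unfolding E_def by blast
    with e have fits: "fits a b e"
      by (simp add: dyadic_in_C_iff)
    have "AE x in lborel. x \<in> F e \<longleftrightarrow> x \<in> {fst e<..<snd e} \<inter> A"
      using AE_lborel_singleton[of "fst e"] by eventually_elim (use fits in \<open>auto simp: F_def fits_def\<close>)
    then show "measure lborel (F e) = (case e of (p, q) \<Rightarrow> measure lborel ({p<..<q} \<inter> A))"
      using A by (auto simp: F_def case_prod_beta intro!: measure_eq_AE)
  qed
  finally show ?thesis .
qed

lemma measure_unif:
  assumes "p < q" "A \<in> sets borel"
  shows "measure (unif p q) A = measure lborel ({p<..<q} \<inter> A) / (q - p)"
  using assms by (simp add: unif_def)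

lemma w_eq_length:
  assumes "e \<in> C a b"
  shows "w a b e = (snd e - fst e) / (b - a)" and "fst e < snd e"
proof -
  obtain k m where "e = dyadic k m"
    using assms C_subset_E[of a b] unfolding E_def by blast
  then show "w a b e = (snd e - fst e) / (b - a)" and "fst e < snd e"
    using assms by (auto simp: w_def dyadic_exp_dyadic) (auto simp: dyadic_def algebra_simps)
qed

lemma unif_mixture:
  assumes "a < b" and A: "A \<in> sets borel"
  shows "((\<lambda>(p, q). w a b (p, q) * measure (unif p q) A) has_sum measure (unif a b) A) E"
proof -
  have "((\<lambda>e. (case e of (p, q) \<Rightarrow> measure lborel ({p<..<q} \<inter> A)) * (1 / (b - a))) has_sum
      measure lborel ({a<..<b} \<inter> A) * (1 / (b - a))) (C a b)"
    by (intro has_sum_cmult_left has_sum_lborel_over_maximal_dyadic_intervals A)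
  also have "measure lborel ({a<..<b} \<inter> A) * (1 / (b - a)) = measure (unif a b) A"
    using assms by (simp add: measure_unif)
  also have "((\<lambda>e. (case e of (p, q) \<Rightarrow> measure lborel ({p<..<q} \<inter> A)) * (1 / (b - a))) has_sum
      measure (unif a b) A) (C a b) \<longleftrightarrow> ?thesis"
  proof (rule has_sum_cong_neutral)
    fix e assume "e \<in> C a b \<inter> E"
    then have "e \<in> C a b" by simp
    from w_eq_length[OF this] show
      "(case e of (p, q) \<Rightarrow> measure lborel ({p<..<q} \<inter> A)) * (1 / (b - a)) =
        (case e of (p, q) \<Rightarrow> w a b (p, q) * measure (unif p q) A)"
      using A by (cases e) (simp add: measure_unif)
  qed (use C_subset_E in \<open>auto simp: w_def\<close>)
  finally show ?thesis .
qed

lemma w_nonneg: "a < b \<Longrightarrow> 0 \<le> w a b e"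
  by (simp add: w_def)

lemma has_sum_w:
  assumes "a < b"
  shows "(w a b has_sum 1) E"
proof -
  have one: "measure (unif p q) UNIV = 1" if "p < q" for p q
    using that by (simp add: measure_unif)
  have "((\<lambda>(p, q). w a b (p, q) * measure (unif p q) UNIV) has_sum 1) E"
    using unif_mixture[OF assms, of UNIV] by (simp add: one assms)
  also have "?this \<longleftrightarrow> ?thesis"
  proof (rule has_sum_cong)
    fix e assume "e \<in> E"
    then have "fst e < snd e"
      by (auto simp: E_def dyadic_def algebra_simps)
    then show "(case e of (p, q) \<Rightarrow> w a b (p, q) * measure (unif p q) UNIV) = w a b e"
      by (cases e) (simp add: one)
  qed
  finally show ?thesis .
qed

theorem theorem1:
  fixes a b :: real
  assumes "(a, b) \<in> Theta"
  shows "(\<forall>e\<in>E. 0 \<le> w a b e) \<and> (w a b has_sum 1) E \<and>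
    (\<forall>A\<in>sets borel.
       ((\<lambda>(p, q). w a b (p, q) * measure (unif p q) A) has_sum measure (unif a b) A) E)"
  using assms w_nonneg has_sum_w unif_mixture by (simp add: Theta_def)

end
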